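(* Let $n\ge 2$, let $M^{n-1}$ be a compact $(n-1)$-dimensional manifold and let $h:M^{n-1}\to\mathbb R^n$ be a $C^1$ immersion. Then $h$ is substantial, and each point $p$ in the boundary of $\operatorname{Conv}[h(M^{n-1})]$ admits a unique supporting hyperplane $H_p$. Moreover, the map $p\mapsto H_p$, defined on the boundary of $\operatorname{Conv}[h(M^{n-1})]$, is continuous.
   Context: Manifolds are connected and without boundary. $\operatorname{Conv}(A)$ denotes the convex hull of $A\subset\mathbb R^n$, and its boundary is its topological boundary in $\mathbb R^n$. The map $h$ is substantial if $h(M)$ is not contained in a proper affine subspace of $\mathbb R^n$. A supporting hyperplane of $C=\operatorname{Conv}[h(M)]$ at a boundary point $p$ is an affine hyperplane through $p$ such that $C$ is contained in one of the two closed half-spaces it bounds. Continuity of $p\mapsto H_p$ is with respect to the usual topology on the space of affine hyperplanes of $\mathbb R^n$; since $p\in H_p$, this is equivalent to continuity of $p\mapsto [H_p]^{\perp}\in G(1,n)$, where $[H_p]^{\perp}$ is the normal line of $H_p$ and $G(1,n)$ is the space of lines through the origin. *)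

theory Defs
  imports "HOL-Analysis.Analysis"
begin

section \<open>\<open>C\<^sup>1\<close> manifolds and immersions\<close>

text \<open>Meant for open \<open>S\<close>. The library's \<^const>\<open>C1_differentiable_on\<close> only covers functions of
  one real variable.\<close>

definition C1_on :: "('b::euclidean_space \<Rightarrow> 'c::euclidean_space) \<Rightarrow> 'b set \<Rightarrow> bool" where
  "C1_on f S \<longleftrightarrow>
     (\<exists>f'. (\<forall>x\<in>S. (f has_derivative blinfun_apply (f' x)) (at x)) \<and> continuous_on S f')"

text \<open>A chart is a pair \<open>(U, \<phi>)\<close>. Only the restriction of \<open>\<phi>\<close> to \<open>U\<close> matters, and the inverse
  chart is \<^term>\<open>inv_into U \<phi>\<close>.\<close>

definition chart_on :: "'a topology \<Rightarrow> 'a set \<Rightarrow> ('a \<Rightarrow> 'b::euclidean_space) \<Rightarrow> bool" where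
  "chart_on X U \<phi> \<longleftrightarrow>
     openin X U \<and> open (\<phi> ` U) \<and>
     homeomorphic_map (subtopology X U) (top_of_set (\<phi> ` U)) \<phi>"

definition C1_atlas :: "'a topology \<Rightarrow> ('a set \<times> ('a \<Rightarrow> 'b::euclidean_space)) set \<Rightarrow> bool" where
  "C1_atlas X A \<longleftrightarrow>
     (\<forall>(U, \<phi>)\<in>A. chart_on X U \<phi>) \<and>
     (\<Union>(U, \<phi>)\<in>A. U) = topspace X \<and>
     (\<forall>(U, \<phi>)\<in>A. \<forall>(V, \<psi>)\<in>A. C1_on (\<psi> \<circ> inv_into U \<phi>) (\<phi> ` (U \<inter> V)))"

text \<open>Manifolds are without boundary (charts map onto open subsets of the model space) and
  connected. Connected manifolds are understood to be nonempty, which \<^const>\<open>connected_space\<close>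
  does not include. The dimension is that of the model space \<^typ>\<open>'b\<close>.\<close>

definition C1_manifold :: "'a topology \<Rightarrow> ('a set \<times> ('a \<Rightarrow> 'b::euclidean_space)) set \<Rightarrow> bool" where
  "C1_manifold X A \<longleftrightarrow>
     Hausdorff_space X \<and> second_countable X \<and> connected_space X \<and> topspace X \<noteq> {} \<and>
     C1_atlas X A"

definition C1_immersion ::
    "('a set \<times> ('a \<Rightarrow> 'b::euclidean_space)) set \<Rightarrow> ('a \<Rightarrow> 'c::euclidean_space) \<Rightarrow> bool" where
  "C1_immersion A h \<longleftrightarrow>
     (\<forall>(U, \<phi>)\<in>A. C1_on (h \<circ> inv_into U \<phi>) (\<phi> ` U) \<and>
        (\<forall>x\<in>\<phi> ` U. inj (frechet_derivative (h \<circ> inv_into U \<phi>) (at x))))"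

definition substantial :: "'a topology \<Rightarrow> ('a \<Rightarrow> 'c::euclidean_space) \<Rightarrow> bool" where
  "substantial X h \<longleftrightarrow> \<not> (\<exists>S. affine S \<and> S \<noteq> UNIV \<and> h ` topspace X \<subseteq> S)"


section \<open>Hyperplanes\<close>

definition hyperplane :: "'c::euclidean_space \<times> real \<Rightarrow> 'c set" where
  "hyperplane = (\<lambda>(a, b). {x. a \<bullet> x = b})"

definition hyperplane_params :: "('c::euclidean_space \<times> real) set" where
  "hyperplane_params = (- {0}) \<times> UNIV"

definition supporting_hyperplane :: "'c::euclidean_space set \<Rightarrow> 'c \<Rightarrow> 'c set \<Rightarrow> bool" where
  "supporting_hyperplane C p H \<longleftrightarrow>
     p \<in> H \<and>
     (\<exists>a b. a \<noteq> 0 \<and> H = {x. a \<bullet> x = b} \<and> (C \<subseteq> {x. a \<bullet> x \<le> b} \<or> C \<subseteq> {x. a \<bullet> x \<ge> b}))"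

text \<open>The usual topology on the space of affine hyperplanes is the quotient topology under
  the parametrization by a nonzero normal vector and an offset (see \<open>quotient_map_hyperplane\<close>
  below).\<close>

definition hyperplane_topology :: "'c::euclidean_space set topology" where
  "hyperplane_topology =
     topology (\<lambda>W. W \<subseteq> hyperplane ` hyperplane_params \<and>
       openin (top_of_set hyperplane_params) {z \<in> hyperplane_params. hyperplane z \<in> W})"

lemma openin_hyperplane_topology:
  "openin hyperplane_topology W \<longleftrightarrow>
     W \<subseteq> hyperplane ` hyperplane_params \<and>
     openin (top_of_set hyperplane_params) {z \<in> hyperplane_params. hyperplane z \<in> W}"
proof -
  have "istopology (\<lambda>W. W \<subseteq> hyperplane ` hyperplane_params \<and>
       openin (top_of_set hyperplane_params) {z \<in> hyperplane_params. hyperplane z \<in> W})"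
    (is "istopology ?L")
    unfolding istopology_def
  proof (intro conjI allI impI)
    fix S T assume "?L S" "?L T"
    moreover have "{z \<in> hyperplane_params. hyperplane z \<in> S \<inter> T} =
        {z \<in> hyperplane_params. hyperplane z \<in> S} \<inter> {z \<in> hyperplane_params. hyperplane z \<in> T}"
      by auto
    ultimately show "S \<inter> T \<subseteq> hyperplane ` hyperplane_params"
      and "openin (top_of_set hyperplane_params) {z \<in> hyperplane_params. hyperplane z \<in> S \<inter> T}"
      by (auto intro: openin_Int)
  next
    fix K assume K: "\<forall>S\<in>K. ?L S"
    then show "\<Union> K \<subseteq> hyperplane ` hyperplane_params"
      by blast
    have "{z \<in> hyperplane_params. hyperplane z \<in> \<Union> K} =
        (\<Union>S\<in>K. {z \<in> hyperplane_params. hyperplane z \<in> S})"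
      by auto
    then show "openin (top_of_set hyperplane_params) {z \<in> hyperplane_params. hyperplane z \<in> \<Union> K}"
      using K by (auto intro!: openin_Union)
  qed
  then show ?thesis
    unfolding hyperplane_topology_def by (subst topology_inverse') (assumption, rule refl)
qed

lemma topspace_hyperplane_topology:
  "topspace (hyperplane_topology :: 'c::euclidean_space set topology) =
     hyperplane ` hyperplane_params"
proof
  show "topspace (hyperplane_topology :: 'c set topology) \<subseteq> hyperplane ` hyperplane_params"
    using openin_topspace openin_hyperplane_topology by blast
  have "{z \<in> hyperplane_params. hyperplane z \<in> hyperplane ` hyperplane_params} =
      (hyperplane_params :: ('c \<times> real) set)"
    by auto
  then have "openin (hyperplane_topology :: 'c set topology) (hyperplane ` hyperplane_params)"
    by (simp only: openin_hyperplane_topology openin_subtopology_self subset_refl simp_thms)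
  then show "hyperplane ` hyperplane_params \<subseteq> topspace (hyperplane_topology :: 'c set topology)"
    by (rule openin_subset)
qed

lemma quotient_map_hyperplane:
  "quotient_map (top_of_set hyperplane_params) hyperplane_topology hyperplane"
  by (simp add: quotient_map_def topspace_hyperplane_topology openin_hyperplane_topology)

end

theory Submission
  imports Defs
begin

text \<open>If a linear functional \<open>a\<close> attains its maximum over \<open>h(M)\<close> at \<open>h(x)\<close>, then
  \<open>a \<circ> h\<close> is critical at \<open>x\<close>, so that \<open>a\<^sup>\<bottom>\<close> contains the image of \<open>dh\<^sub>x\<close> and equals it by dimension.
  Hence any two functionals with a maximum at the same point are parallel. Since \<open>n \<ge> 2\<close>, this
  excludes that \<open>h(M)\<close> lies in a hyperplane. A functional that is maximal over the hull at \<open>p\<close> is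
  also maximal at every point of \<open>h(M)\<close> with positive weight in a convex representation of \<open>p\<close>,
  which gives uniqueness of the supporting hyperplane. Finally, the unit outward normal has a
  closed graph in the product with the compact unit sphere, so it depends continuously on \<open>p\<close>.\<close>

section \<open>Maxima of linear functionals on an immersed hypersurface\<close>

text \<open>The right-hand side does not mention \<open>a\<close>. This is what later makes two
  functionals with a maximum at the same point comparable.\<close>

lemma hyperplane_eq_range_derivative_at_max:
  fixes g :: "'b::euclidean_space \<Rightarrow> 'c::euclidean_space"
  assumes dim: "DIM('b) = DIM('c) - 1"
    and S: "open S" "x \<in> S"
    and g: "(g has_derivative g') (at x)" "inj g'"
    and a: "a \<noteq> 0" "\<And>y. y \<in> S \<Longrightarrow> a \<bullet> g y \<le> a \<bullet> g x"
  shows "{v. a \<bullet> v = 0} = range g'"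
proof -
  have lin: "linear g'"
    using g(1) by (rule has_derivative_linear)
  have "((\<lambda>y. a \<bullet> g y) has_derivative (\<lambda>v. a \<bullet> g' v)) (at x)"
    by (intro derivative_intros g)
  then have "(\<lambda>v. a \<bullet> g' v) = (\<lambda>v. 0)"
    using S a(2) by (intro differential_zero_maxmin[of x S "\<lambda>y. a \<bullet> g y"]) auto
  then have "range g' \<subseteq> {v. a \<bullet> v = 0}"
    by (auto dest: fun_cong)
  moreover have "dim (range g') = DIM('c) - 1"
    using dim_image_eq[OF lin, of UNIV] g(2) dim by simp
  ultimately have "range g' = {v. a \<bullet> v = 0}"
    using lin a(1)
    by (intro subspace_dim_equal)
      (auto simp: dim_hyperplane subspace_hyperplane intro: linear_subspace_image)
  then show ?thesis
    by simp
qed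

text \<open>In one chart around \<open>x\<close>, both kernels are the range of the same derivative,
  since a maximum over all of \<open>M\<close> is also a maximum over the chart domain.\<close>

lemma immersion_normals_at_max:
  fixes h :: "'a \<Rightarrow> 'c::euclidean_space" and A :: "('a set \<times> ('a \<Rightarrow> 'b::euclidean_space)) set"
  assumes dim: "DIM('b) = DIM('c) - 1"
    and atlas: "C1_atlas M A" and imm: "C1_immersion A h"
    and x: "x \<in> topspace M"
    and a: "a \<noteq> 0" "\<And>y. y \<in> topspace M \<Longrightarrow> a \<bullet> h y \<le> a \<bullet> h x"
    and b: "b \<noteq> 0" "\<And>y. y \<in> topspace M \<Longrightarrow> b \<bullet> h y \<le> b \<bullet> h x"
  shows "{v. a \<bullet> v = 0} = {v. b \<bullet> v = 0}"
proof -
  obtain U \<phi> where U: "(U, \<phi>) \<in> A" "x \<in> U"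
    using atlas x unfolding C1_atlas_def by blast
  have chart: "chart_on M U \<phi>"
    using atlas U unfolding C1_atlas_def by blast
  then have UM: "U \<subseteq> topspace M" and op: "open (\<phi> ` U)"
    unfolding chart_on_def by (auto dest: openin_subset)
  have inj: "inj_on \<phi> U"
    using chart UM unfolding chart_on_def
    by (auto dest!: homeomorphic_imp_injective_map simp: Int_absorb1)
  define g where "g = h \<circ> inv_into U \<phi>"
  have g: "g (\<phi> y) = h y" if "y \<in> U" for y
    using inj that by (simp add: g_def)
  have "C1_on g (\<phi> ` U)" and "inj (frechet_derivative g (at (\<phi> x)))"
    using imm U unfolding C1_immersion_def g_def by blast+
  \<comment> \<open>\<open>C1_on\<close> provides some derivative, whereas injectivity is stated for
    \<open>frechet_derivative\<close>; differentiability links the two.\<close>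
  then have deriv: "(g has_derivative frechet_derivative g (at (\<phi> x))) (at (\<phi> x))"
    using U(2) frechet_derivative_works unfolding C1_on_def differentiable_def by blast
  have "{v. c \<bullet> v = 0} = range (frechet_derivative g (at (\<phi> x)))"
    if "c \<noteq> 0" "\<And>y. y \<in> topspace M \<Longrightarrow> c \<bullet> h y \<le> c \<bullet> h x" for c
    using that UM U(2) g
    by (intro hyperplane_eq_range_derivative_at_max[OF dim op _ deriv])
       (auto simp: \<open>inj (frechet_derivative g (at (\<phi> x)))\<close>)
  then show ?thesis
    using a b by simp
qed

text \<open>Needed for the compactness of \<open>h(M)\<close>. On each chart domain,
  \<open>h\<close> factors through the chart as a differentiable map after a homeomorphism, and the
  chart domains form an open cover.\<close>

lemma immersion_continuous_map:
  fixes h :: "'a \<Rightarrow> 'c::euclidean_space" and A :: "('a set \<times> ('a \<Rightarrow> 'b::euclidean_space)) set"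
  assumes atlas: "C1_atlas M A" and imm: "C1_immersion A h"
  shows "continuous_map M euclidean h"
proof (rule pasting_lemma[where I = A and T = fst and f = "\<lambda>_. h"])
  fix c assume "c \<in> A"
  moreover obtain U \<phi> where c: "c = (U, \<phi>)"
    by fastforce
  ultimately have chart: "chart_on M U \<phi>" and "C1_on (h \<circ> inv_into U \<phi>) (\<phi> ` U)"
    using atlas imm unfolding C1_atlas_def C1_immersion_def by auto
  then have "continuous_on (\<phi> ` U) (h \<circ> inv_into U \<phi>)"
    unfolding C1_on_def
    by (meson continuous_at_imp_continuous_on has_derivative_continuous)
  moreover have hom: "homeomorphic_map (subtopology M U) (top_of_set (\<phi> ` U)) \<phi>"
    and opU: "openin M U"
    using chart by (auto simp: chart_on_def)
  ultimately have "continuous_map (subtopology M U) euclidean ((h \<circ> inv_into U \<phi>) \<circ> \<phi>)"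
    by (intro continuous_map_compose[where X' = "top_of_set (\<phi> ` U)"]) (auto dest: homeomorphic_imp_continuous_map)
  moreover have "inj_on \<phi> U"
    using homeomorphic_imp_injective_map[OF hom] openin_subset[OF opU] by (simp add: Int_absorb1)
  ultimately show "continuous_map (subtopology M (fst c)) euclidean h"
    by (auto simp: c elim!: continuous_map_eq)
  show "openin M (fst c)"
    using opU by (simp add: c)
next
  fix x assume "x \<in> topspace M"
  then show "\<exists>c. c \<in> A \<and> x \<in> fst c \<and> h x = h x"
    using atlas unfolding C1_atlas_def by fastforce
qed simp

section \<open>Supporting functionals and hyperplanes of convex sets\<close>

text \<open>The point \<open>q\<close> depends on \<open>p\<close> only, so it serves all
  functionals \<open>a\<close> at once. The gaps \<open>a \<bullet> p - a \<bullet> v\<close> are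
  nonnegative and their weighted mean is zero, hence the gap vanishes wherever the weight is
  nonzero.\<close>

lemma convex_hull_supported_generator:
  assumes "p \<in> convex hull S"
  obtains q where "q \<in> S"
    and "\<And>a. (\<And>x. x \<in> S \<Longrightarrow> a \<bullet> x \<le> a \<bullet> p) \<Longrightarrow> a \<bullet> q = a \<bullet> (p :: 'c::real_inner)"
proof -
  obtain T u where T: "finite T" "T \<subseteq> S" "\<And>x. x \<in> T \<Longrightarrow> 0 \<le> u x" "sum u T = 1"
    and p: "(\<Sum>v\<in>T. u v *\<^sub>R v) = p"
    using assms by (auto simp: convex_hull_explicit)
  obtain q where q: "q \<in> T" "u q \<noteq> 0"
    using T(4) by (metis sum.neutral zero_neq_one)
  show thesis
  proof
    show "q \<in> S"
      using q T by blast
    fix a assume a: "\<And>x. x \<in> S \<Longrightarrow> a \<bullet> x \<le> a \<bullet> p"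
    have "(\<Sum>v\<in>T. u v * (a \<bullet> p - a \<bullet> v)) = (\<Sum>v\<in>T. u v) * (a \<bullet> p) - a \<bullet> (\<Sum>v\<in>T. u v *\<^sub>R v)"
      by (simp add: right_diff_distrib sum_subtractf sum_distrib_right inner_sum_right)
    also have "\<dots> = 0"
      by (simp add: T p)
    finally have "\<forall>v\<in>T. u v * (a \<bullet> p - a \<bullet> v) = 0"
      using T a by (subst (asm) sum_nonneg_eq_0_iff) (auto intro!: mult_nonneg_nonneg)
    then show "a \<bullet> q = a \<bullet> p"
      using q by auto
  qed
qed

lemma eq_or_eq_minus_if_hyperplanes_eq:
  fixes a b :: "'c::real_inner"
  assumes "{v. a \<bullet> v = 0} = {v. b \<bullet> v = 0}" "norm a = 1" "norm b = 1"
  shows "b = a \<or> b = - a"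
proof -
  \<comment> \<open>The component of \<open>b\<close> orthogonal to \<open>a\<close>. It lies in
    both kernels, so it is orthogonal to itself.\<close>
  define w where "w = b - (b \<bullet> a) *\<^sub>R a"
  have "a \<bullet> w = 0"
    using assms(2) by (simp add: w_def inner_diff_right inner_commute dot_square_norm)
  moreover from this have "b \<bullet> w = 0"
    using assms(1) by blast
  ultimately have "w \<bullet> w = 0"
    by (subst w_def) (simp add: inner_diff_left)
  then have b: "b = (b \<bullet> a) *\<^sub>R a"
    by (simp add: w_def)
  then have "norm b = \<bar>b \<bullet> a\<bar> * norm a"
    by (metis norm_scaleR)
  then have "\<bar>b \<bullet> a\<bar> = 1"
    using assms by simp
  then show ?thesis
    using b by (metis abs_eq_iff abs_1 scaleR_minus1_left scaleR_one)
qed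

text \<open>A sign \<open>s\<close> turns the normal so that \<open>C\<close> lies on the \<le>
  side, and scaling makes it a unit vector; the offset is determined by
  \<open>p \<in> H\<close>.\<close>

lemma supporting_hyperplane_outward:
  assumes "supporting_hyperplane C p H"
  obtains a where "norm a = 1" "\<And>x. x \<in> C \<Longrightarrow> a \<bullet> x \<le> a \<bullet> p" "H = {x. a \<bullet> x = a \<bullet> p}"
proof -
  obtain a b where a: "a \<noteq> 0" "H = {x. a \<bullet> x = b}" "a \<bullet> p = b"
    and C: "C \<subseteq> {x. a \<bullet> x \<le> b} \<or> C \<subseteq> {x. a \<bullet> x \<ge> b}"
    using assms unfolding supporting_hyperplane_def by blast
  have "\<exists>s\<in>{1, -1}. \<forall>x\<in>C. (s *\<^sub>R a) \<bullet> x \<le> (s *\<^sub>R a) \<bullet> p"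
    using C a(3) by auto
  then obtain s :: real where s: "s = 1 \<or> s = -1" "\<And>x. x \<in> C \<Longrightarrow> (s *\<^sub>R a) \<bullet> x \<le> (s *\<^sub>R a) \<bullet> p"
    by blast
  show thesis
  proof
    show "norm ((s / norm a) *\<^sub>R a) = 1"
      using a(1) s(1) by auto
    show "((s / norm a) *\<^sub>R a) \<bullet> x \<le> ((s / norm a) *\<^sub>R a) \<bullet> p" if "x \<in> C" for x
      using s(2)[OF that] a(1) by (simp add: divide_right_mono)
    show "H = {x. ((s / norm a) *\<^sub>R a) \<bullet> x = ((s / norm a) *\<^sub>R a) \<bullet> p}"
      using a s(1) by auto
  qed
qed

lemma supporting_hyperplane_exists:
  fixes C :: "'c::euclidean_space set"
  assumes "convex C" "closed C" "affine hull C = UNIV" "p \<in> frontier C"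
  shows "\<exists>H. supporting_hyperplane C p H"
proof -
  \<comment> \<open>The full affine hull makes the relative interior the interior, so topological
    boundary points are relative boundary points.\<close>
  have "p \<in> C" "p \<notin> rel_interior C"
    using assms by (auto simp: frontier_def rel_interior_interior)
  then obtain a where "a \<noteq> 0" "\<And>y. y \<in> C \<Longrightarrow> a \<bullet> p \<le> a \<bullet> y"
    using supporting_hyperplane_rel_boundary[OF assms(1)] by metis
  then have "supporting_hyperplane C p {x. a \<bullet> x = a \<bullet> p}"
    unfolding supporting_hyperplane_def by blast
  then show ?thesis ..
qed

text \<open>Uniqueness identifies the graph of \<open>N\<close> with the part of
  \<open>F \<times> sphere 0 1\<close> cut out by closed inequalities. A map into a compact set with
  closed graph is continuous.\<close>

lemma continuous_on_outward_normal:
  fixes C :: "'c::euclidean_space set"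
  assumes "\<And>p. p \<in> F \<Longrightarrow> norm (N p) = 1"
    and N: "\<And>p x. p \<in> F \<Longrightarrow> x \<in> C \<Longrightarrow> N p \<bullet> x \<le> N p \<bullet> p"
    and unique: "\<And>p a. p \<in> F \<Longrightarrow> norm a = 1 \<Longrightarrow> (\<And>x. x \<in> C \<Longrightarrow> a \<bullet> x \<le> a \<bullet> p) \<Longrightarrow> a = N p"
  shows "continuous_on F N"
proof -
  have N_in: "N \<in> F \<rightarrow> sphere 0 1"
    using assms(1) by auto
  have "(\<lambda>p. (p, N p)) ` F =
      (F \<times> sphere 0 1) \<inter> (\<Inter>x\<in>C. {z. snd z \<bullet> x \<le> snd z \<bullet> fst z})"
    using assms by (auto simp: image_iff)
  moreover have "closed (\<Inter>x\<in>C. {z::'c \<times> 'c. snd z \<bullet> x \<le> snd z \<bullet> fst z})"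
    by (intro closed_INT ballI closed_Collect_le continuous_intros)
  ultimately have "closedin (top_of_set (F \<times> sphere 0 1)) ((\<lambda>p. (p, N p)) ` F)"
    by (simp add: closedin_closed_Int)
  then show ?thesis
    using N_in by (simp add: continuous_closed_graph_eq[OF compact_sphere])
qed

theorem corollary1p6:
  fixes M :: "'a topology"
    and A :: "('a set \<times> ('a \<Rightarrow> real ^ 'm)) set"
    and h :: "'a \<Rightarrow> real ^ 'n"
  assumes "CARD('n) \<ge> 2"
    and "CARD('m) = CARD('n) - 1"
    and "C1_manifold M A"
    and "compact_space M"
    and "C1_immersion A h"
  shows "substantial M h \<and>
    (\<forall>p\<in>frontier (convex hull (h ` topspace M)). \<exists>!H. supporting_hyperplane (convex hull (h ` topspace M)) p H) \<and>
    continuous_map (top_of_set (frontier (convex hull (h ` topspace M)))) hyperplane_topology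
      (\<lambda>p. THE H. supporting_hyperplane (convex hull (h ` topspace M)) p H)"
proof -
  have atlas: "C1_atlas M A" and ne: "topspace M \<noteq> {}"
    using assms(3) by (auto simp: C1_manifold_def)
  define K where "K = h ` topspace M"
  define C where "C = convex hull K"
  have "compact K"
    using image_compactin[of M "topspace M" euclidean h] assms(4,5) atlas
    by (simp add: K_def compact_space_def immersion_continuous_map compactin_euclidean_iff)
  then have "compact C"
    by (simp add: C_def compact_convex_hull)
  have "convex C" and KC: "K \<subseteq> C"
    by (simp_all add: C_def convex_convex_hull hull_subset)

  have K_parallel: "{v. a \<bullet> v = 0} = {v. b \<bullet> v = 0}"
    if q: "q \<in> K" and ab: "a \<noteq> 0" "\<And>x. x \<in> K \<Longrightarrow> a \<bullet> x \<le> a \<bullet> q" "b \<noteq> 0" "\<And>x. x \<in> K \<Longrightarrow> b \<bullet> x \<le> b \<bullet> q"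
    for q a b
  proof -
    obtain x where "x \<in> topspace M" "q = h x"
      using q by (auto simp: K_def)
    then show ?thesis
      using ab assms(2)
      by (intro immersion_normals_at_max[OF _ atlas assms(5)]) (auto simp: K_def)
  qed
  have parallel: "{v. a \<bullet> v = 0} = {v. b \<bullet> v = 0}"
    if p: "p \<in> C" and a: "a \<noteq> 0" "\<And>x. x \<in> C \<Longrightarrow> a \<bullet> x \<le> a \<bullet> p"
      and b: "b \<noteq> 0" "\<And>x. x \<in> C \<Longrightarrow> b \<bullet> x \<le> b \<bullet> p" for p a b
  proof -
    obtain q where q: "q \<in> K" "\<And>c. (\<And>x. x \<in> K \<Longrightarrow> c \<bullet> x \<le> c \<bullet> p) \<Longrightarrow> c \<bullet> q = c \<bullet> p"
      using convex_hull_supported_generator p unfolding C_def by metis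
    have "a \<bullet> q = a \<bullet> p" "b \<bullet> q = b \<bullet> p"
      using q(2) a(2) b(2) KC by blast+
    then show ?thesis
      using q(1) a b KC by (intro K_parallel[of q]) auto
  qed

  have full: "affine hull K = UNIV"
  proof (rule ccontr)
    assume "affine hull K \<noteq> UNIV"
    then have "aff_dim K < DIM(real ^ 'n)"
      by (metis aff_dim_eq_full aff_dim_le_DIM order_less_le)
    then obtain a c where a: "a \<noteq> 0" "K \<subseteq> {x. a \<bullet> x = c}"
      by (rule aff_lowdim_subset_hyperplane)
    \<comment> \<open>Here \<open>n \<ge> 2\<close> enters. Since \<open>a\<close> is constant on
      \<open>K\<close>, it is also maximal wherever \<open>b\<close> is; equal kernels then put
      \<open>b\<close> into its own kernel.\<close>
    obtain b where b: "b \<noteq> 0" "orthogonal a b"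
      using orthogonal_to_vector_exists[of a] assms(1) by auto
    have "continuous_on K (\<lambda>x. b \<bullet> x)"
      by (intro continuous_intros)
    then obtain q where q: "q \<in> K" "\<And>x. x \<in> K \<Longrightarrow> b \<bullet> x \<le> b \<bullet> q"
      using continuous_attains_sup[OF \<open>compact K\<close>] ne unfolding K_def by blast
    have "a \<bullet> x \<le> a \<bullet> q" if "x \<in> K" for x
      using subsetD[OF a(2) that] subsetD[OF a(2) q(1)] by simp
    then have "{v. a \<bullet> v = 0} = {v. b \<bullet> v = 0}"
      using a(1) b(1) q by (intro K_parallel)
    then have "b \<bullet> b = 0"
      using b(2) unfolding orthogonal_def by blast
    then show False
      using b(1) by simp
  qed
  then have fullC: "affine hull C = UNIV"
    by (simp add: C_def affine_hull_convex_hull)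
  have "substantial M h"
    unfolding substantial_def K_def[symmetric] using full hull_minimal[of K _ affine] by blast

  have unique: "\<exists>!H. supporting_hyperplane C p H" if "p \<in> frontier C" for p
  proof (rule ex_ex1I)
    show "\<exists>H. supporting_hyperplane C p H"
      using \<open>convex C\<close> \<open>compact C\<close> fullC that
      by (intro supporting_hyperplane_exists) (auto intro: compact_imp_closed)
    fix H H' assume "supporting_hyperplane C p H" "supporting_hyperplane C p H'"
    then obtain a b where a: "norm a = 1" "\<And>x. x \<in> C \<Longrightarrow> a \<bullet> x \<le> a \<bullet> p" "H = {x. a \<bullet> x = a \<bullet> p}"
      and b: "norm b = 1" "\<And>x. x \<in> C \<Longrightarrow> b \<bullet> x \<le> b \<bullet> p" "H' = {x. b \<bullet> x = b \<bullet> p}"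
      by (metis supporting_hyperplane_outward)
    have "p \<in> C"
      using that \<open>compact C\<close> by (simp add: frontier_def compact_imp_closed)
    moreover have "a \<noteq> 0" "b \<noteq> 0"
      using a(1) b(1) by auto
    ultimately have "{v. a \<bullet> v = 0} = {v. b \<bullet> v = 0}"
      using a(2) b(2) by (intro parallel)
    \<comment> \<open>Both hyperplanes are translates by \<open>p\<close> of the common
      kernel.\<close>
    then have "a \<bullet> (x - p) = 0 \<longleftrightarrow> b \<bullet> (x - p) = 0" for x
      by blast
    then show "H = H'"
      by (auto simp: a(3) b(3) inner_diff_right)
  qed

  have "\<exists>a. norm a = 1 \<and> (\<forall>x\<in>C. a \<bullet> x \<le> a \<bullet> p) \<and>
      (THE H. supporting_hyperplane C p H) = {x. a \<bullet> x = a \<bullet> p}" if "p \<in> frontier C" for p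
    using theI'[OF unique[OF that]] by (rule supporting_hyperplane_outward) blast
  then obtain N where N: "\<And>p. p \<in> frontier C \<Longrightarrow> norm (N p) = 1"
      "\<And>p x. p \<in> frontier C \<Longrightarrow> x \<in> C \<Longrightarrow> N p \<bullet> x \<le> N p \<bullet> p"
    and the: "\<And>p. p \<in> frontier C \<Longrightarrow>
      (THE H. supporting_hyperplane C p H) = {x. N p \<bullet> x = N p \<bullet> p}"
    by metis
  have "continuous_on (frontier C) N"
  proof (rule continuous_on_outward_normal[where C = C])
    fix p a assume p: "p \<in> frontier C" and a: "norm a = 1" "\<And>x. x \<in> C \<Longrightarrow> a \<bullet> x \<le> a \<bullet> p"
    have "p \<in> C"
      using p \<open>compact C\<close> by (simp add: frontier_def compact_imp_closed)
    moreover have "N p \<noteq> 0" "a \<noteq> 0"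
      using N(1)[OF p] a(1) by auto
    ultimately have "{v. N p \<bullet> v = 0} = {v. a \<bullet> v = 0}"
      using N(2)[OF p] a(2) by (intro parallel)
    then have "a = N p \<or> a = - N p"
      using N(1)[OF p] a(1) by (rule eq_or_eq_minus_if_hyperplanes_eq)
    \<comment> \<open>Opposite functionals both maximal at \<open>p\<close> would be constant on
      \<open>C\<close>, contradicting its full affine hull; the point \<open>a + p\<close> lies off
      the hyperplane.\<close>
    moreover have False if "a = - N p"
    proof -
      have "C \<subseteq> {x. a \<bullet> x = a \<bullet> p}"
        using N(2)[OF p] a(2) that by force
      then have "UNIV \<subseteq> {x. a \<bullet> x = a \<bullet> p}"
        using fullC hull_minimal[of C _ affine] affine_hyperplane by metis
      then have "a \<bullet> (a + p) = a \<bullet> p"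
        by blast
      then show False
        using \<open>a \<noteq> 0\<close> by (simp add: inner_add_right)
    qed
    ultimately show "a = N p"
      by blast
  qed (use N in auto)
  \<comment> \<open>This lifts the map to normal-offset pairs; composing with the quotient map
    \<open>hyperplane\<close> gives continuity into the space of hyperplanes.\<close>
  then have "continuous_on (frontier C) (\<lambda>p. (N p, N p \<bullet> p))"
    by (intro continuous_intros)
  moreover have "(N p, N p \<bullet> p) \<in> hyperplane_params" if "p \<in> frontier C" for p
    using N(1)[OF that] by (auto simp: hyperplane_params_def)
  ultimately have "continuous_map (top_of_set (frontier C)) (top_of_set hyperplane_params)
      (\<lambda>p. (N p, N p \<bullet> p))"
    by auto
  then have "continuous_map (top_of_set (frontier C)) hyperplane_topology
      (hyperplane \<circ> (\<lambda>p. (N p, N p \<bullet> p)))"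
    using quotient_map_hyperplane quotient_imp_continuous_map continuous_map_compose by blast
  then have "continuous_map (top_of_set (frontier C)) hyperplane_topology
      (\<lambda>p. THE H. supporting_hyperplane C p H)"
    by (rule continuous_map_eq) (simp add: the hyperplane_def)
  with \<open>substantial M h\<close> unique show ?thesis
    by (simp add: C_def K_def)
qed

end
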